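(* Let $\Sigma=\{0,1\}$. For every $X\in\Sigma^\infty$, $$\dim_{\mathrm{FS}}^{\mathrm{multi-bet}}(X)=H^{sliding}(X),$$ i.e. the multi-bet finite state dimension of $X$ equals the sliding block entropy rate of $X$.
   Context: $\Sigma=\{0,1\}$; $X\restriction n$ is the string of the first $n$ symbols of $X\in\Sigma^\infty$; for a string $x$, $x[a:b]$ is the substring from index $a$ to index $b-1$ (indices start at $0$); $\lambda$ is the empty string; $\log$ is base 2 and $0\log0=0$. Multi-bet finite state dimension. For an integer $k\ge1$, a $k$-bet finite-state gambler is a tuple $G=(Q,\delta,\vec\beta,q_0,c_0)$ with $Q$ a nonempty finite set of states, $\delta:Q\times\{0,1\}\to Q$ the transition function, $\vec\beta=(\beta_1,\dots,\beta_k):Q\to(\mathbb{Q}\cap[0,1])^k$ the betting function, $q_0\in Q$ the initial state, and $c_0$ a nonnegative rational (initial capital). For $w\in\{0,1\}^*$ write $\beta_i(w)$ for $\beta_i$ evaluated at the state reached from $q_0$ after reading $w$. For $s\in[0,\infty)$ the induced $s$-product-gale ($k$-bet finite state $s$-gale) $d_G^s:\{0,1\}^*\to[0,\infty)$ is given by $d_G^s(\lambda)=c_0$ and, for $b\in\{0,1\}$, $d_G^s(wb)=d_G^s(w)\prod_{i=1}^k 2^s\left[(1-b)(1-\beta_i(w))+b\,\beta_i(w)\right]$. It succeeds on $X$ if $\limsup_{n\to\infty}d_G^s(X\restriction n)=\infty$. Let $\mathcal{G}_{FS}^{\mathrm{multi-bet}}(X)$ be the set of $s\in[0,1]$ for which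 there exist $k\ge1$ and a $k$-bet finite-state gambler $G$ such that $d_G^s$ succeeds on $X$, and $\dim_{\mathrm{FS}}^{\mathrm{multi-bet}}(X)=\inf\mathcal{G}_{FS}^{\mathrm{multi-bet}}(X)$, the infimum being taken in $[0,1]$ (so $\inf\emptyset=1$). Sliding block entropy rate. For $\ell\ge1$, $n\ge\ell$, $x\in\Sigma^n$ and $u\in\Sigma^\ell$ let $N(u,x)=|\{0\le i\le n-\ell: x[i:i+\ell]=u\}|$ and $P(u,x)=N(u,x)/(n-\ell+1)$. Let $H_\ell^{sliding}(x)=-\frac{1}{\ell\log|\Sigma|}\sum_{u\in\Sigma^\ell}P(u,x)\log P(u,x)$, $H_\ell^{sliding}(X)=\liminf_{n\to\infty}H_\ell^{sliding}(X\restriction n)$ and $H^{sliding}(X)=\inf_{\ell\ge1}H_\ell^{sliding}(X)$. *)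

theory Defs
  imports "HOL-Analysis.Analysis"
begin

text \<open>The alphabet \<open>{0, 1}\<close> is \<^typ>\<open>bool\<close>, with \<^term>\<open>False\<close> for 0 and \<^term>\<open>True\<close> for 1.\<close>

definition prefix_of :: "(nat \<Rightarrow> bool) \<Rightarrow> nat \<Rightarrow> bool list" where
  "prefix_of X n = map X [0..<n]"

definition substring :: "bool list \<Rightarrow> nat \<Rightarrow> nat \<Rightarrow> bool list" where
  "substring x a b = take (b - a) (drop a x)"

subsection \<open>Multi-bet finite-state gamblers\<close>

record 'q gambler =
  states :: "'q set"
  trans :: "'q \<Rightarrow> bool \<Rightarrow> 'q"
  bet :: "nat \<Rightarrow> 'q \<Rightarrow> real"
  init :: 'q
  capital :: real

text \<open>Only the values \<open>bet G i q\<close> with \<open>i \<in> {1..k}\<close> and \<open>q \<in> states G\<close> are relevant.\<close>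

definition is_gambler :: "nat \<Rightarrow> 'q gambler \<Rightarrow> bool" where
  "is_gambler k G \<longleftrightarrow>
     finite (states G) \<and> states G \<noteq> {} \<and>
     (\<forall>q\<in>states G. \<forall>b. trans G q b \<in> states G) \<and>
     (\<forall>i\<in>{1..k}. \<forall>q\<in>states G. bet G i q \<in> \<rat> \<and> bet G i q \<in> {0..1}) \<and>
     init G \<in> states G \<and>
     capital G \<in> \<rat> \<and> capital G \<ge> 0"

definition state_after :: "'q gambler \<Rightarrow> bool list \<Rightarrow> 'q" where
  "state_after G w = foldl (trans G) (init G) w"

function product_gale :: "nat \<Rightarrow> 'q gambler \<Rightarrow> real \<Rightarrow> bool list \<Rightarrow> real" where
  "product_gale k G s [] = capital G"
| "product_gale k G s (w @ [b]) =
     product_gale k G s w *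
     (\<Prod>i=1..k. 2 powr s *
        ((1 - of_bool b) * (1 - bet G i (state_after G w)) + of_bool b * bet G i (state_after G w)))"
  by (atomize_elim, metis rev_exhaust surj_pair) auto
termination
  by (relation "Wellfounded.measure (\<lambda>(k, G, s, w). length w)") auto

definition succeeds_on :: "(bool list \<Rightarrow> real) \<Rightarrow> (nat \<Rightarrow> bool) \<Rightarrow> bool" where
  "succeeds_on d X \<longleftrightarrow> limsup (\<lambda>n. ereal (d (prefix_of X n))) = \<infinity>"

text \<open>State sets are taken inside \<^typ>\<open>nat\<close>: up to renaming of states, this covers all
  finite-state gamblers.\<close>

definition multi_bet_set :: "(nat \<Rightarrow> bool) \<Rightarrow> real set" where
  "multi_bet_set X =
     {s \<in> {0..1}. \<exists>k\<ge>1. \<exists>G :: nat gambler. is_gambler k G \<and> succeeds_on (product_gale k G s) X}"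

text \<open>The infimum is taken in \<open>[0, 1]\<close>, so it is 1 for the empty set.\<close>

definition multi_bet_dim :: "(nat \<Rightarrow> bool) \<Rightarrow> real" where
  "multi_bet_dim X = (if multi_bet_set X = {} then 1 else Inf (multi_bet_set X))"

subsection \<open>Sliding block entropy rate\<close>

definition occurrences :: "bool list \<Rightarrow> bool list \<Rightarrow> nat" where
  "occurrences u x =
     card {i. i + length u \<le> length x \<and> substring x i (i + length u) = u}"

definition frequency :: "bool list \<Rightarrow> bool list \<Rightarrow> real" where
  "frequency u x = real (occurrences u x) / (real (length x) - real (length u) + 1)"

text \<open>The convention \<open>0 log 0 = 0\<close> holds automatically. The value is only meaningful for
  \<open>1 \<le> l \<le> length x\<close>; shorter \<open>x\<close> do not affect the limit inferior below.\<close>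

definition block_entropy :: "nat \<Rightarrow> bool list \<Rightarrow> real" where
  "block_entropy l x =
     - (1 / (real l * log 2 (real CARD(bool)))) *
       (\<Sum>u | length u = l. frequency u x * log 2 (frequency u x))"

definition liminf_block_entropy :: "nat \<Rightarrow> (nat \<Rightarrow> bool) \<Rightarrow> ereal" where
  "liminf_block_entropy l X = liminf (\<lambda>n. ereal (block_entropy l (prefix_of X n)))"

definition sliding_entropy_rate :: "(nat \<Rightarrow> bool) \<Rightarrow> ereal" where
  "sliding_entropy_rate X = (INF l\<in>{1..}. liminf_block_entropy l X)"

end

theory Submission
  imports Defs
begin

text \<open>If the block entropy of length \<open>l\<close> is below \<open>s\<close> at infinitely many prefixes, take a distribution close
  to the sliding \<open>l\<close>-block frequencies and place \<open>l\<close> bets, the \<open>i\<close>-th using the conditional probability of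
  the next bit given the last \<open>i - 1\<close> bits. By the chain rule, the product of the bets collects the full
  block probability of every sliding window, so its logarithm grows like \<open>l n (s - H\<^sub>l)\<close>.

  Conversely, fix one of the bets of a gambler with state set \<open>Q\<close>. Its log-factors are nonpositive, so
  \<open>l\<close> times their sum is at most their sum over all sliding windows of length \<open>l\<close>. The factors along
  a window are a probability of the window given the entry state, which is at most \<open>|Q|\<close> times a fixed
  probability distribution; Gibbs' inequality bounds the total by the window entropy, with an
  error \<open>log |Q| / l\<close> per bit that vanishes as \<open>l\<close> grows.\<close>

subsection \<open>Gibbs' inequality and sums over windows\<close>

text \<open>Termwise consequence of ln x \<le> x - 1 at x = \<open>r u / p u\<close>. Positivity of
  \<open>r\<close> on the support of \<open>p\<close> has to be assumed because
  \<open>log 2 0\<close> is an ordinary real number here, not minus infinity.\<close>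

lemma gibbs_inequality:
  fixes p r :: "'a \<Rightarrow> real"
  assumes "finite A" and p: "\<And>u. u \<in> A \<Longrightarrow> p u \<ge> 0" and r: "\<And>u. u \<in> A \<Longrightarrow> r u \<ge> 0"
    and pos: "\<And>u. u \<in> A \<Longrightarrow> p u > 0 \<Longrightarrow> r u > 0"
    and le: "sum r A \<le> sum p A"
  shows "(\<Sum>u\<in>A. p u * log 2 (r u)) \<le> (\<Sum>u\<in>A. p u * log 2 (p u))"
proof -
  have "p u * log 2 (r u) - p u * log 2 (p u) \<le> (r u - p u) / ln 2" if u: "u \<in> A" for u
  proof (cases "p u = 0")
    case True
    then show ?thesis using r[OF u] by simp
  next
    case False
    with p[OF u] have pu: "p u > 0" by simp
    with pos u have ru: "r u > 0" by blast
    have "p u * ln (r u / p u) \<le> p u * (r u / p u - 1)"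
      using pu ru by (intro mult_left_mono ln_le_minus_one) auto
    also have "\<dots> = r u - p u" using pu by (simp add: field_simps)
    finally have "p u * ln (r u / p u) / ln 2 \<le> (r u - p u) / ln 2"
      by (intro divide_right_mono) auto
    then show ?thesis using pu ru by (simp add: log_def ln_div diff_divide_distrib right_diff_distrib)
  qed
  then have "(\<Sum>u\<in>A. p u * log 2 (r u) - p u * log 2 (p u)) \<le> (\<Sum>u\<in>A. (r u - p u) / ln 2)"
    by (rule sum_mono)
  also have "\<dots> = (sum r A - sum p A) / ln 2"
    by (simp add: sum_divide_distrib[symmetric] sum_subtractf)
  also have "\<dots> \<le> 0" using le by (simp add: divide_nonpos_pos)
  finally show ?thesis by (simp add: sum_subtractf)
qed

text \<open>Discarding nonpositive terms can only increase a sum. Both directions of the theorem use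
  this to pass between sums over time and sums over windows.\<close>

lemma sum_shift_ge:
  fixes g :: "nat \<Rightarrow> real"
  assumes "\<And>t. t < m \<Longrightarrow> g t \<le> 0" and "n + j \<le> m"
  shows "(\<Sum>t<m. g t) \<le> (\<Sum>t<n. g (t + j))"
proof -
  have "(\<Sum>t<n. g (t + j)) = (\<Sum>t\<in>{j..<n + j}. g t)"
    using sum.shift_bounds_nat_ivl[of g 0 j n] by (simp add: atLeast0LessThan)
  moreover have "(\<Sum>t\<in>{..<m}. g t) = (\<Sum>t\<in>{j..<n + j}. g t) + (\<Sum>t\<in>{..<m} - {j..<n + j}. g t)"
    using assms(2) by (subst sum.subset_diff[of "{j..<n + j}"]) auto
  moreover have "(\<Sum>t\<in>{..<m} - {j..<n + j}. g t) \<le> 0"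
    using assms(1) by (intro sum_nonpos) auto
  ultimately show ?thesis by linarith
qed

section \<open>Words of fixed length and sliding-window counts\<close>

lemma finite_lists_length: "finite {u :: bool list. length u = l}"
  using finite_lists_length_eq[of "UNIV :: bool set" l] by simp

lemma card_lists_length: "card {u :: bool list. length u = l} = 2 ^ l"
  using card_lists_length_eq[of "UNIV :: bool set" l] by simp

lemma sum_lists_length_Suc:
  fixes f :: "bool list \<Rightarrow> 'a::comm_monoid_add"
  shows "(\<Sum>u | length u = Suc l. f u) =
    (\<Sum>u | length u = l. f (True # u)) + (\<Sum>u | length u = l. f (False # u))"
proof -
  have eq: "{u. length u = Suc l} = Cons True ` {u. length u = l} \<union> Cons False ` {u. length u = l}"
    by (auto simp: length_Suc_conv image_iff)
  show ?thesis
    unfolding eq using finite_lists_length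
    by (subst sum.union_disjoint) (auto simp: sum.reindex)
qed

lemma prefix_of_Suc: "prefix_of X (Suc n) = prefix_of X n @ [X n]"
  by (simp add: prefix_of_def)

lemma length_prefix_of [simp]: "length (prefix_of X n) = n"
  by (simp add: prefix_of_def)

lemma substring_prefix_of:
  assumes "t + l \<le> n"
  shows "substring (prefix_of X n) t (t + l) = map X [t..<t + l]"
  using assms by (simp add: substring_def prefix_of_def drop_map take_map)

lemma occurrences_prefix_of:
  assumes "length u = l" "l \<le> n"
  shows "occurrences u (prefix_of X n) = card {t \<in> {..<n - l + 1}. map X [t..<t + l] = u}"
proof -
  have "{i. i + length u \<le> length (prefix_of X n) \<and> substring (prefix_of X n) i (i + length u) = u}
    = {t \<in> {..<n - l + 1}. map X [t..<t + l] = u}"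
    using assms by (auto simp: substring_prefix_of)
  then show ?thesis unfolding occurrences_def by (rule arg_cong)
qed

text \<open>Groups the starting positions by the block read there. This links logarithms of capital,
  which are sums over time, to entropies, which are sums over blocks.\<close>

lemma sum_windows:
  fixes f :: "bool list \<Rightarrow> real"
  assumes "l \<le> n"
  shows "(\<Sum>t<n - l + 1. f (map X [t..<t + l])) =
    (\<Sum>u | length u = l. real (occurrences u (prefix_of X n)) * f u)"
proof -
  have "(\<Sum>t<n - l + 1. f (map X [t..<t + l])) =
      (\<Sum>u | length u = l. \<Sum>t\<in>{t \<in> {..<n - l + 1}. map X [t..<t + l] = u}. f (map X [t..<t + l]))"
    by (rule sum.group[symmetric]) (auto simp: finite_lists_length)
  also have "\<dots> = (\<Sum>u | length u = l. real (occurrences u (prefix_of X n)) * f u)"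
    by (rule sum.cong) (auto simp: occurrences_prefix_of[OF _ assms])
  finally show ?thesis .
qed

lemma frequency_prefix_of:
  assumes "length u = l" "l \<le> n"
  shows "frequency u (prefix_of X n) = real (occurrences u (prefix_of X n)) / real (n - l + 1)"
  using assms by (simp add: frequency_def of_nat_diff)

lemma occurrences_eq_frequency:
  assumes "length u = l" "l \<le> n"
  shows "real (occurrences u (prefix_of X n)) = real (n - l + 1) * frequency u (prefix_of X n)"
  unfolding frequency_prefix_of[OF assms] by simp

lemma frequency_nonneg:
  assumes "length u = l" "l \<le> n"
  shows "frequency u (prefix_of X n) \<ge> 0"
  unfolding frequency_prefix_of[OF assms] by simp

lemma sum_frequency:
  assumes "l \<le> n"
  shows "(\<Sum>u | length u = l. frequency u (prefix_of X n)) = 1"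
proof -
  have "real (n - l + 1) = (\<Sum>u | length u = l. real (occurrences u (prefix_of X n)))"
    using sum_windows[OF assms, of "\<lambda>_. 1" X] by simp
  also have "\<dots> = (\<Sum>u | length u = l. real (n - l + 1) * frequency u (prefix_of X n))"
    by (rule sum.cong) (auto simp: occurrences_eq_frequency[OF _ assms])
  also have "\<dots> = real (n - l + 1) * (\<Sum>u | length u = l. frequency u (prefix_of X n))"
    by (rule sum_distrib_left[symmetric])
  finally show ?thesis by (metis add_gr_0 mult_cancel_left1 of_nat_eq_0_iff less_numeral_extra(1,3))
qed

lemma frequency_le_1:
  assumes "length u = l" "l \<le> n"
  shows "frequency u (prefix_of X n) \<le> 1"
proof -
  have "frequency u (prefix_of X n) \<le> (\<Sum>u | length u = l. frequency u (prefix_of X n))"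
    using assms by (intro member_le_sum) (auto simp: finite_lists_length frequency_nonneg[OF _ assms(2)])
  then show ?thesis using sum_frequency[OF assms(2)] by simp
qed

section \<open>Bounds on and by the block entropy\<close>

lemma block_entropy_altdef:
  assumes "l \<ge> 1"
  shows "real l * block_entropy l x = - (\<Sum>u | length u = l. frequency u x * log 2 (frequency u x))"
  using assms by (simp add: block_entropy_def)

lemma block_entropy_nonneg:
  assumes "l \<ge> 1" "l \<le> n"
  shows "block_entropy l (prefix_of X n) \<ge> 0"
proof -
  have "frequency u (prefix_of X n) * log 2 (frequency u (prefix_of X n)) \<le> 0"
    if u: "length u = l" for u
  proof (cases "frequency u (prefix_of X n) = 0")
    case False
    then have "frequency u (prefix_of X n) > 0" using frequency_nonneg[OF u assms(2), of X] by simp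
    then show ?thesis using frequency_le_1[OF u assms(2), of X]
      by (intro mult_nonneg_nonpos) auto
  qed simp
  then have "real l * block_entropy l (prefix_of X n) \<ge> 0"
    unfolding block_entropy_altdef[OF assms(1)] neg_0_le_iff_le by (intro sum_nonpos) auto
  then show ?thesis using assms(1) by (simp add: zero_le_mult_iff)
qed

text \<open>After grouping by blocks the left side is \<open>n - l + 1\<close> times the cross term
  of the empirical distribution with \<open>r\<close>, so Gibbs' inequality applies. Positivity on
  the windows that occur suffices, since these are exactly the blocks of positive frequency.\<close>

lemma sum_windows_log_le_entropy:
  fixes r :: "bool list \<Rightarrow> real"
  assumes l: "l \<ge> 1" "l \<le> n" and r: "\<And>u. r u \<ge> 0"
    and le: "(\<Sum>u | length u = l. r u) \<le> 1"
    and pos: "\<And>t. t < n - l + 1 \<Longrightarrow> r (map X [t..<t + l]) > 0"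
  shows "(\<Sum>t<n - l + 1. log 2 (r (map X [t..<t + l])))
    \<le> - (real (n - l + 1) * (real l * block_entropy l (prefix_of X n)))"
proof -
  have "r u > 0" if u: "length u = l" and f: "frequency u (prefix_of X n) > 0" for u
  proof -
    have "occurrences u (prefix_of X n) \<noteq> 0"
      using f unfolding frequency_prefix_of[OF u l(2)] by (auto simp: zero_less_divide_iff)
    then have "{t \<in> {..<n - l + 1}. map X [t..<t + l] = u} \<noteq> {}"
      unfolding occurrences_prefix_of[OF u l(2)] using card.empty by metis
    then show ?thesis using pos by auto
  qed
  then have G: "(\<Sum>u | length u = l. frequency u (prefix_of X n) * log 2 (r u))
      \<le> (\<Sum>u | length u = l. frequency u (prefix_of X n) * log 2 (frequency u (prefix_of X n)))"
    using le r by (intro gibbs_inequality)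
      (auto simp: finite_lists_length frequency_nonneg[OF _ l(2)] sum_frequency[OF l(2)])
  have "(\<Sum>t<n - l + 1. log 2 (r (map X [t..<t + l]))) =
      (\<Sum>u | length u = l. real (n - l + 1) * (frequency u (prefix_of X n) * log 2 (r u)))"
    unfolding sum_windows[OF l(2), of "\<lambda>u. log 2 (r u)" X]
    by (rule sum.cong) (auto simp: occurrences_eq_frequency[OF _ l(2)])
  also have "\<dots> = real (n - l + 1) * (\<Sum>u | length u = l. frequency u (prefix_of X n) * log 2 (r u))"
    by (rule sum_distrib_left[symmetric])
  also have "\<dots> \<le> real (n - l + 1) *
      (\<Sum>u | length u = l. frequency u (prefix_of X n) * log 2 (frequency u (prefix_of X n)))"
    using G by (intro mult_left_mono) auto
  finally show ?thesis unfolding block_entropy_altdef[OF l(1)] by simp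
qed

text \<open>The preceding bound for the uniform distribution on blocks.\<close>

lemma block_entropy_le_1:
  assumes l: "l \<ge> 1" "l \<le> n"
  shows "block_entropy l (prefix_of X n) \<le> 1"
proof -
  have "real (n - l + 1) * (real l * block_entropy l (prefix_of X n)) \<le> real (n - l + 1) * (real l * 1)"
    using sum_windows_log_le_entropy[OF l, of "\<lambda>_. 1 / 2 ^ l" X]
    by (simp add: card_lists_length log_divide log_nat_power)
  then show ?thesis using l by (simp add: mult_le_cancel_left)
qed

subsection \<open>Product gales\<close>

definition bet_factor :: "'q gambler \<Rightarrow> nat \<Rightarrow> 'q \<Rightarrow> bool \<Rightarrow> real" where
  "bet_factor G i q b = (if b then bet G i q else 1 - bet G i q)"

lemma product_gale_prefix_of:
  "product_gale k G s (prefix_of X n) =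
     capital G * (\<Prod>t<n. \<Prod>i=1..k. 2 powr s * bet_factor G i (state_after G (prefix_of X t)) (X t))"
proof (induction n)
  case 0
  then show ?case by (simp add: prefix_of_def)
next
  case (Suc n)
  have "(1 - of_bool b) * (1 - bet G i q) + of_bool b * bet G i q = bet_factor G i q b" for i q b
    by (simp add: bet_factor_def)
  then show ?case using Suc by (simp add: prefix_of_Suc)
qed

lemma state_after_prefix_of_Suc:
  "state_after G (prefix_of X (Suc t)) = trans G (state_after G (prefix_of X t)) (X t)"
  by (simp add: prefix_of_Suc state_after_def)

lemma state_after_in_states:
  assumes "is_gambler k G"
  shows "state_after G (prefix_of X t) \<in> states G"
proof (induction t)
  case 0
  then show ?case using assms by (simp add: prefix_of_def state_after_def is_gambler_def)
next
  case (Suc t)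
  then show ?case using assms by (simp add: state_after_prefix_of_Suc is_gambler_def)
qed

lemma log_product_gale:
  assumes c: "capital G > 0"
    and pos: "\<And>t i. t < n \<Longrightarrow> i \<in> {1..k} \<Longrightarrow> bet_factor G i (state_after G (prefix_of X t)) (X t) > 0"
  shows "log 2 (product_gale k G s (prefix_of X n)) = log 2 (capital G) + real k * s * real n
     + (\<Sum>i=1..k. \<Sum>t<n. log 2 (bet_factor G i (state_after G (prefix_of X t)) (X t)))"
proof -
  let ?f = "\<lambda>t i. bet_factor G i (state_after G (prefix_of X t)) (X t)"
  have nz: "?f t i \<noteq> 0" if "t < n" "i \<in> {1..k}" for t i
    using pos[OF that] by simp
  have P: "(\<Prod>t<n. \<Prod>i=1..k. 2 powr s * ?f t i) > 0"
    using pos by (intro prod_pos) auto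
  have "ln (\<Prod>t<n. \<Prod>i=1..k. 2 powr s * ?f t i) = (\<Sum>t<n. ln (\<Prod>i=1..k. 2 powr s * ?f t i))"
    using nz by (intro ln_prod) auto
  also have "\<dots> = (\<Sum>t<n. \<Sum>i=1..k. ln (2 powr s * ?f t i))"
    using nz by (intro sum.cong ln_prod) auto
  also have "\<dots> = (\<Sum>t<n. \<Sum>i=1..k. s * ln 2 + ln (?f t i))"
    using nz by (intro sum.cong refl) (auto simp: ln_mult ln_powr)
  also have "\<dots> = real k * s * real n * ln 2 + (\<Sum>t<n. \<Sum>i=1..k. ln (?f t i))"
    by (simp add: sum.distrib algebra_simps)
  \<comment> \<open>Exchanging the sums separates the bets, so that each one can be estimated on its
    own.\<close>
  also have "(\<Sum>t<n. \<Sum>i=1..k. ln (?f t i)) = (\<Sum>i=1..k. \<Sum>t<n. ln (?f t i))"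
    by (rule sum.swap)
  finally have "ln (\<Prod>t<n. \<Prod>i=1..k. 2 powr s * ?f t i) =
      real k * s * real n * ln 2 + (\<Sum>i=1..k. \<Sum>t<n. ln (?f t i))" .
  then show ?thesis
    unfolding product_gale_prefix_of log_mult_pos[OF c P]
    by (simp add: log_def add_divide_distrib sum_divide_distrib)
qed

subsection \<open>The entropy rate is at most the dimension\<close>

text \<open>Bet \<open>i\<close> is read as the conditional probability that the next bit is 1. For
  a fixed start state this gives a probability measure on the words of each length.\<close>

fun path_prob :: "'q gambler \<Rightarrow> nat \<Rightarrow> 'q \<Rightarrow> bool list \<Rightarrow> real" where
  "path_prob G i q [] = 1"
| "path_prob G i q (b # u) = bet_factor G i q b * path_prob G i (trans G q b) u"

lemma path_prob_nonneg:
  assumes "is_gambler k G" "i \<in> {1..k}" "q \<in> states G"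
  shows "path_prob G i q u \<ge> 0"
  using assms(3)
proof (induction u arbitrary: q)
  case (Cons b u)
  then show ?case using assms(1,2) by (auto simp: is_gambler_def bet_factor_def intro!: mult_nonneg_nonneg)
qed simp

lemma sum_path_prob: "(\<Sum>u | length u = l. path_prob G i q u) = 1"
proof (induction l arbitrary: q)
  case (Suc l)
  then show ?case by (simp add: sum_lists_length_Suc sum_distrib_left[symmetric] bet_factor_def)
qed simp

lemma path_prob_window:
  "(\<Prod>j<l. bet_factor G i (state_after G (prefix_of X (t + j))) (X (t + j)))
   = path_prob G i (state_after G (prefix_of X t)) (map X [t..<t + l])"
proof (induction l arbitrary: t)
  case (Suc l)
  have "map X [t..<t + Suc l] = X t # map X [Suc t..<Suc t + l]"
    by (simp add: upt_conv_Cons del: upt_Suc)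
  then show ?case
    using Suc[of "Suc t"] by (simp add: prod.lessThan_Suc_shift state_after_prefix_of_Suc
      del: upt_Suc prod.lessThan_Suc)
qed simp

lemma sum_log_bet_factor_le:
  assumes G: "is_gambler k G" and i: "i \<in> {1..k}" and l: "l \<ge> 1" "l \<le> n"
    and pos: "\<And>t. t < n \<Longrightarrow> bet_factor G i (state_after G (prefix_of X t)) (X t) > 0"
  shows "(\<Sum>t<n. log 2 (bet_factor G i (state_after G (prefix_of X t)) (X t)))
    \<le> real (n - l + 1) * (log 2 (real (card (states G))) / real l - block_entropy l (prefix_of X n))"
proof -
  define q where "q t = state_after G (prefix_of X t)" for t
  define g where "g t = log 2 (bet_factor G i (q t) (X t))" for t
  define S where "S = real (card (states G))"
  \<comment> \<open>Averaging over the states makes the bound independent of the state in which a window is entered,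
    at the cost of a factor \<open>S\<close>.\<close>
  define r where "r u = (\<Sum>p\<in>states G. path_prob G i p u) / S" for u
  have fin: "finite (states G)" "states G \<noteq> {}" using G by (auto simp: is_gambler_def)
  then have S: "S > 0" by (simp add: S_def card_gt_0_iff)
  have q: "q t \<in> states G" for t
    unfolding q_def using state_after_in_states[OF G] .
  have f: "bet_factor G i (q t) (X t) \<le> 1" for t
    using q[of t] G i by (auto simp: is_gambler_def bet_factor_def)
  have pos': "bet_factor G i (q t) (X t) > 0" if "t < n" for t
    using pos[OF that] by (simp add: q_def)
  have g0: "g t \<le> 0" if "t < n" for t
    using f[of t] pos'[OF that] by (simp add: g_def)
  have r0: "r u \<ge> 0" for u
    unfolding r_def using S path_prob_nonneg[OF G i] by (intro divide_nonneg_pos sum_nonneg) auto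
  have "(\<Sum>u | length u = l. r u) = (\<Sum>p\<in>states G. \<Sum>u | length u = l. path_prob G i p u) / S"
    unfolding r_def sum_divide_distrib[symmetric] by (subst sum.swap) simp
  then have r1: "(\<Sum>u | length u = l. r u) = 1"
    using S by (simp add: sum_path_prob S_def)
  have w: "0 < r (map X [t..<t + l]) \<and> (\<Sum>j<l. g (t + j)) \<le> log 2 S + log 2 (r (map X [t..<t + l]))"
    if t: "t < n - l + 1" for t
  proof -
    let ?u = "map X [t..<t + l]"
    have p: "bet_factor G i (q (t + j)) (X (t + j)) > 0" if "j < l" for j
      using pos'[of "t + j"] t that l by simp
    have eq: "(\<Prod>j<l. bet_factor G i (q (t + j)) (X (t + j))) = path_prob G i (q t) ?u"
      unfolding q_def by (rule path_prob_window)
    have pp: "path_prob G i (q t) ?u > 0"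
      unfolding eq[symmetric] using p by (intro prod_pos) auto
    have "path_prob G i (q t) ?u \<le> (\<Sum>p\<in>states G. path_prob G i p ?u)"
      using fin q path_prob_nonneg[OF G i] by (intro member_le_sum) auto
    then have le: "path_prob G i (q t) ?u \<le> S * r ?u"
      using S by (simp add: r_def)
    with pp S have rp: "r ?u > 0" by (metis less_le_trans zero_less_mult_pos)
    have "(\<Sum>j<l. g (t + j)) = log 2 (path_prob G i (q t) ?u)"
      unfolding eq[symmetric] g_def log_def
      using p by (subst ln_prod) (fastforce simp: sum_divide_distrib)+
    also have "\<dots> \<le> log 2 (S * r ?u)" using le pp by simp
    also have "\<dots> = log 2 S + log 2 (r ?u)" using S rp by (simp add: log_mult)
    finally show ?thesis using rp by simp
  qed
  \<comment> \<open>Each offset \<open>j < l\<close> takes one copy of the sum and keeps only the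
    positions \<open>t + j\<close> with \<open>t\<close> the start of a complete window; the terms
    dropped are nonpositive.\<close>
  have "real l * (\<Sum>t<n. g t) = (\<Sum>j<l. \<Sum>t<n. g t)" by simp
  also have "\<dots> \<le> (\<Sum>j<l. \<Sum>t<n - l + 1. g (t + j))"
    using g0 l by (intro sum_mono sum_shift_ge) auto
  also have "\<dots> = (\<Sum>t<n - l + 1. \<Sum>j<l. g (t + j))"
    by (rule sum.swap)
  also have "\<dots> \<le> (\<Sum>t<n - l + 1. log 2 S + log 2 (r (map X [t..<t + l])))"
    using w by (intro sum_mono) auto
  also have "\<dots> = real (n - l + 1) * log 2 S + (\<Sum>t<n - l + 1. log 2 (r (map X [t..<t + l])))"
    by (simp add: sum.distrib)
  also have "\<dots> \<le> real (n - l + 1) * log 2 S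
      - (real (n - l + 1) * (real l * block_entropy l (prefix_of X n)))"
    using sum_windows_log_le_entropy[OF l, of r X] r0 r1 w by fastforce
  also have "\<dots> = real l * (real (n - l + 1) * (log 2 S / real l - block_entropy l (prefix_of X n)))"
  proof -
    have "N * a - N * (real l * B) = real l * (N * (a / real l - B))" for N a B :: real
      using l by (simp add: field_simps)
    then show ?thesis .
  qed
  finally have "real l * (\<Sum>t<n. g t) \<le> \<dots>" .
  then show ?thesis using l by (simp add: g_def q_def S_def mult_le_cancel_left)
qed

text \<open>One zero factor would make the whole product vanish. The conclusions are the hypotheses
  of \<open>log_product_gale\<close>.\<close>

lemma product_gale_pos_imp:
  assumes G: "is_gambler k G" and pos: "product_gale k G s (prefix_of X n) > 0"
  shows "capital G > 0"
    and "\<And>t i. t < n \<Longrightarrow> i \<in> {1..k} \<Longrightarrow> bet_factor G i (state_after G (prefix_of X t)) (X t) > 0"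
proof -
  have "capital G \<ge> 0" "capital G \<noteq> 0"
    using G pos unfolding product_gale_prefix_of by (auto simp: is_gambler_def)
  then show "capital G > 0" by simp
  fix t i assume ti: "t < n" "i \<in> {1..k}"
  have "bet_factor G i (state_after G (prefix_of X t)) (X t) \<noteq> 0"
  proof
    assume "bet_factor G i (state_after G (prefix_of X t)) (X t) = 0"
    then have "(\<Prod>i=1..k. 2 powr s * bet_factor G i (state_after G (prefix_of X t)) (X t)) = 0"
      using ti(2) by (intro prod_zero) auto
    then have "(\<Prod>t<n. \<Prod>i=1..k. 2 powr s * bet_factor G i (state_after G (prefix_of X t)) (X t)) = 0"
      using ti(1) by (intro prod_zero) auto
    with pos show False unfolding product_gale_prefix_of by (metis mult_zero_right less_irrefl)
  qed
  moreover have "bet_factor G i (state_after G (prefix_of X t)) (X t) \<ge> 0"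
    using state_after_in_states[OF G, of X t] G ti by (auto simp: is_gambler_def bet_factor_def)
  ultimately show "bet_factor G i (state_after G (prefix_of X t)) (X t) > 0" by simp
qed

text \<open>If the entropy were eventually above the bound, each of the \<open>k\<close> bets would
  lose at least \<open>s\<close> bits per window. This cancels the gain from the factors
  \<open>2 powr s\<close> up to a constant, so the capital would stay bounded.\<close>

lemma liminf_block_entropy_le:
  assumes G: "is_gambler k G" and succ: "succeeds_on (product_gale k G s) X"
    and s: "s \<ge> 0" and l: "l \<ge> 1"
  shows "liminf_block_entropy l X \<le> ereal (s + log 2 (real (card (states G))) / real l)"
proof (rule ccontr)
  let ?B = "s + log 2 (real (card (states G))) / real l"
  let ?d = "\<lambda>n. product_gale k G s (prefix_of X n)"
  assume "\<not> ?thesis"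
  then have "ereal ?B < liminf (\<lambda>n. ereal (block_entropy l (prefix_of X n)))"
    by (simp add: liminf_block_entropy_def)
  then have "\<forall>\<^sub>F n in sequentially. ereal ?B < ereal (block_entropy l (prefix_of X n))"
    by (rule less_LiminfD)
  \<comment> \<open>The term \<open>real k * s * real l\<close> pays for the fewer than
    \<open>l\<close> positions by which the number of windows falls short of \<open>n\<close>; the
    maximum with 0 covers prefixes where the capital is not positive.\<close>
  then have "\<forall>\<^sub>F n in sequentially. ?d n \<le> max 0 (2 powr (log 2 (capital G) + real k * s * real l))"
    using eventually_ge_at_top[of l]
  proof eventually_elim
    case (elim n)
    show ?case
    proof (cases "?d n > 0")
      case True
      note pos = product_gale_pos_imp[OF G True]
      define N where "N = real (n - l + 1)"
      have N: "N \<ge> 0" "N \<ge> real n - real l" using elim(2) by (auto simp: N_def)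
      have "(\<Sum>t<n. log 2 (bet_factor G i (state_after G (prefix_of X t)) (X t))) \<le> N * (- s)"
        if i: "i \<in> {1..k}" for i
      proof -
        have "(\<Sum>t<n. log 2 (bet_factor G i (state_after G (prefix_of X t)) (X t)))
            \<le> N * (log 2 (real (card (states G))) / real l - block_entropy l (prefix_of X n))"
          unfolding N_def using pos(2)[OF _ i] by (intro sum_log_bet_factor_le[OF G i l elim(2)])
        also have "\<dots> \<le> N * (- s)"
          using elim(1) N by (intro mult_left_mono) auto
        finally show ?thesis .
      qed
      then have "(\<Sum>i=1..k. \<Sum>t<n. log 2 (bet_factor G i (state_after G (prefix_of X t)) (X t)))
          \<le> (\<Sum>i=1..k. N * (- s))" by (rule sum_mono)
      also have "\<dots> = - (real k * s) * N" by simp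
      also have "\<dots> \<le> - (real k * s) * (real n - real l)"
        using N s by (intro mult_left_mono_neg) auto
      finally have "log 2 (?d n) \<le> log 2 (capital G) + real k * s * real l"
        using log_product_gale[OF pos, where s = s] by (simp add: algebra_simps)
      then have "?d n \<le> 2 powr (log 2 (capital G) + real k * s * real l)"
        using True by (simp add: log_le_iff)
      then show ?thesis by simp
    next
      case False
      then show ?thesis by (intro max.coboundedI1) simp
    qed
  qed
  then have "limsup (\<lambda>n. ereal (?d n)) \<le> ereal (max 0 (2 powr (log 2 (capital G) + real k * s * real l)))"
    by (intro Limsup_bounded) (auto elim: eventually_mono)
  with succ show False by (simp add: succeeds_on_def)
qed

text \<open>The gambler is fixed while \<open>l\<close> tends to infinity, so the cost of its states
  per bit vanishes.\<close>

lemma sliding_entropy_rate_le: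
  assumes G: "is_gambler k G" and succ: "succeeds_on (product_gale k G s) X" and s: "s \<ge> 0"
  shows "sliding_entropy_rate X \<le> ereal s"
proof (rule LIMSEQ_le_const)
  have "(\<lambda>l. s + log 2 (real (card (states G))) / real l) \<longlonglongrightarrow> s + 0"
    by (intro tendsto_intros lim_const_over_n)
  then show "(\<lambda>l. ereal (s + log 2 (real (card (states G))) / real l)) \<longlonglongrightarrow> ereal s"
    by simp
  have "sliding_entropy_rate X \<le> ereal (s + log 2 (real (card (states G))) / real l)" if "l \<ge> 1" for l
    unfolding sliding_entropy_rate_def using that liminf_block_entropy_le[OF G succ s that]
    by (intro INF_lower2[of l]) auto
  then show "\<exists>N. \<forall>l\<ge>N. sliding_entropy_rate X \<le> ereal (s + log 2 (real (card (states G))) / real l)"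
    by blast
qed

subsection \<open>The dimension is at most the entropy rate\<close>

text \<open>An unnormalised cylinder measure on \<open>l\<close>-blocks, with \<open>v = []\<close>
  giving the normalising constant. Natural weights make the conditional probabilities, and hence the
  bets, rational.\<close>

definition ext_weight :: "(bool list \<Rightarrow> nat) \<Rightarrow> nat \<Rightarrow> bool list \<Rightarrow> nat" where
  "ext_weight w l v = (\<Sum>u | length u = l - length v. w (v @ u))"

lemma ext_weight_split:
  assumes "length v < l"
  shows "ext_weight w l v = ext_weight w l (v @ [True]) + ext_weight w l (v @ [False])"
proof -
  from assms have "l - length v = Suc (l - Suc (length v))" by simp
  then show ?thesis by (simp add: ext_weight_def sum_lists_length_Suc)
qed

lemma ext_weight_full: "length v = l \<Longrightarrow> ext_weight w l v = w v"
  by (simp add: ext_weight_def)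

text \<open>Keeps every conditional probability well defined and every factor of the window gambler
  positive.\<close>

lemma ext_weight_pos:
  assumes "\<And>u. w u > 0"
  shows "ext_weight w l v > 0"
proof -
  have "replicate (l - length v) False \<in> {u. length u = l - length v}" by simp
  then have "{u :: bool list. length u = l - length v} \<noteq> {}" by blast
  then show ?thesis
    unfolding ext_weight_def using finite_lists_length assms by (intro sum_pos)
qed

text \<open>The state is the window of the last \<open>l - 1\<close> bits, initially padded with zeros. Bet \<open>i\<close> predicts
  the next bit from the last \<open>i - 1\<close> ones, using the conditional probabilities of the distribution on
  \<open>l\<close>-blocks proportional to \<open>w\<close>.\<close>

definition window_gambler :: "(bool list \<Rightarrow> nat) \<Rightarrow> nat \<Rightarrow> nat gambler" where
  "window_gambler w l =
    \<lparr>states = to_nat ` {u :: bool list. length u = l - 1},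
     trans = (\<lambda>q b. to_nat (tl ((from_nat q :: bool list) @ [b]))),
     bet = (\<lambda>i q. let v = drop (l - i) (from_nat q :: bool list)
                  in real (ext_weight w l (v @ [True])) / real (ext_weight w l v)),
     init = to_nat (replicate (l - 1) False),
     capital = 1\<rparr>"

section \<open>Legality and gain of the window gambler\<close>

lemma window_gambler_is_gambler:
  assumes w: "\<And>u. w u > 0" and l: "l \<ge> 1"
  shows "is_gambler l (window_gambler w l)"
proof -
  \<comment> \<open>The context of bet \<open>i\<close> consists of
    \<open>(l - 1) - (l - i) = i - 1\<close> bits, so contexts shorter than \<open>l\<close> cover
    all bets.\<close>
  have "real (ext_weight w l (v @ [True])) / real (ext_weight w l v) \<in> \<rat> \<inter> {0..1}"
    if "length v < l" for v
  proof -
    have "ext_weight w l (v @ [True]) \<le> ext_weight w l v"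
      using ext_weight_split[OF that, of w] by simp
    then show ?thesis using ext_weight_pos[of w l v, OF w] by simp
  qed
  then show ?thesis
    using l finite_lists_length[of "l - 1"] Ex_list_of_length[of "l - 1"]
    unfolding is_gambler_def window_gambler_def by (auto simp: Let_def)
qed

text \<open>With \<open>m\<close> zeros in front, the states of the first steps are windows like all
  others, at the price of boundedly many windows that do not come from \<open>X\<close>.\<close>

definition padded :: "nat \<Rightarrow> (nat \<Rightarrow> bool) \<Rightarrow> nat \<Rightarrow> bool" where
  "padded m X t \<longleftrightarrow> m \<le> t \<and> X (t - m)"

lemma map_padded: "map (padded m X) [t + m..<t + m + l] = map X [t..<t + l]"
  by (rule nth_equalityI) (auto simp: padded_def)

lemma state_after_window_gambler:
  "state_after (window_gambler w (Suc m)) (prefix_of X t) = to_nat (map (padded m X) [t..<t + m])"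
proof (induction t)
  case 0
  have "map (padded m X) [0..<m] = replicate m False"
    by (rule nth_equalityI) (auto simp: padded_def)
  then show ?case by (simp add: state_after_def prefix_of_def window_gambler_def)
next
  case (Suc t)
  have "map (padded m X) [t..<t + m] @ [X t] = map (padded m X) [t..<Suc (t + m)]"
    by (simp add: padded_def)
  also have "\<dots> = padded m X t # map (padded m X) [Suc t..<Suc t + m]"
    by (simp add: upt_conv_Cons del: upt_Suc)
  finally show ?case
    using Suc by (simp add: state_after_prefix_of_Suc window_gambler_def del: upt_Suc)
qed

text \<open>Indexed by the start of the window instead of the time of the bet, so that for fixed
  \<open>t\<close> the product over \<open>i\<close> telescopes.\<close>

definition cond_weight :: "(bool list \<Rightarrow> nat) \<Rightarrow> nat \<Rightarrow> (nat \<Rightarrow> bool) \<Rightarrow> nat \<Rightarrow> nat \<Rightarrow> real" where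
  "cond_weight w l Y i t =
     real (ext_weight w l (map Y [t..<t + i])) / real (ext_weight w l (map Y [t..<t + (i - 1)]))"

text \<open>At time \<open>t\<close> the bit at stake sits at padded position \<open>t + m\<close>.
  Bet \<open>i\<close> sees the \<open>i - 1\<close> bits before it, so its window starts at
  \<open>t + m - (i - 1) = t + (Suc m - i)\<close>.\<close>

lemma bet_factor_window_gambler:
  assumes w: "\<And>u. w u > 0" and i: "i \<in> {1..Suc m}"
  shows "bet_factor (window_gambler w (Suc m)) i
      (state_after (window_gambler w (Suc m)) (prefix_of X t)) (X t)
    = cond_weight w (Suc m) (padded m X) i (t + (Suc m - i))"
proof -
  let ?Y = "padded m X" and ?W = "ext_weight w (Suc m)"
  define v where "v = map ?Y [t + (Suc m - i)..<t + (Suc m - i) + (i - 1)]"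
  have e: "t + (Suc m - i) + (i - 1) = t + m" "t + (Suc m - i) + i = Suc (t + m)" using i by auto
  have d: "drop (Suc m - i) (map ?Y [t..<t + m]) = v"
    unfolding v_def e by (simp add: drop_map)
  have vX: "map ?Y [t + (Suc m - i)..<t + (Suc m - i) + i] = v @ [X t]"
    unfolding v_def e using i by (auto simp: padded_def)
  have "length v < Suc m" using i by (auto simp: v_def)
  from ext_weight_split[OF this, of w]
  have "real (?W (v @ [False])) = real (?W v) - real (?W (v @ [True]))" by simp
  with ext_weight_pos[of w "Suc m" v, OF w] have "1 - real (?W (v @ [True])) / real (?W v) = real (?W (v @ [False])) / real (?W v)"
    by (simp add: diff_divide_distrib)
  then show ?thesis
    unfolding cond_weight_def vX v_def[symmetric] state_after_window_gambler
    by (cases "X t") (simp_all add: bet_factor_def window_gambler_def d Let_def)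
qed

lemma cond_weight_bounds:
  assumes w: "\<And>u. w u > 0" and i: "i \<in> {1..l}"
  shows "0 < cond_weight w l Y i t" "cond_weight w l Y i t \<le> 1"
proof -
  define v where "v = map Y [t..<t + (i - 1)]"
  have v: "map Y [t..<t + i] = v @ [Y (t + (i - 1))]"
    using i by (cases i) (auto simp: v_def)
  have "length v < l" using i by (auto simp: v_def)
  from ext_weight_split[OF this, of w] have "ext_weight w l (v @ [b]) \<le> ext_weight w l v" for b
    by (cases b) auto
  then show "0 < cond_weight w l Y i t" "cond_weight w l Y i t \<le> 1"
    unfolding cond_weight_def v v_def[symmetric] using ext_weight_pos[of w, OF w] by auto
qed

lemma bet_factor_window_gambler_pos:
  assumes w: "\<And>u. w u > 0" and i: "i \<in> {1..l}"
  shows "bet_factor (window_gambler w l) i (state_after (window_gambler w l) (prefix_of X t)) (X t) > 0"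
proof -
  obtain m where m: "l = Suc m" using i by (cases l) auto
  show ?thesis
    unfolding m bet_factor_window_gambler[of w i m X t, OF w i[unfolded m]]
    by (rule cond_weight_bounds(1)[of w, OF w i[unfolded m]])
qed

text \<open>The chain rule, by telescoping. General \<open>j\<close> serves the induction; at
  \<open>j = l\<close> the remaining numerator is the weight of the full block.\<close>

lemma sum_log_cond_weight:
  assumes w: "\<And>u. w u > 0" and "j \<le> l"
  shows "(\<Sum>i=1..j. log 2 (cond_weight w l Y i t)) =
    log 2 (real (ext_weight w l (map Y [t..<t + j]))) - log 2 (real (ext_weight w l []))"
  using assms(2)
proof (induction j)
  case (Suc j)
  have "log 2 (cond_weight w l Y (Suc j) t) = log 2 (real (ext_weight w l (map Y [t..<t + Suc j])))
      - log 2 (real (ext_weight w l (map Y [t..<t + j])))"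
    unfolding cond_weight_def using ext_weight_pos[of w, OF w] by (simp add: log_divide)
  then show ?case using Suc by simp
qed simp

lemma window_gambler_gain:
  assumes w: "\<And>u. w u > 0" and l: "l \<ge> 1" "l \<le> n"
  defines "W \<equiv> real (ext_weight w l [])"
  shows "log 2 (product_gale l (window_gambler w l) s (prefix_of X n)) \<ge>
    real l * s * real n + (\<Sum>t<n - l + 1. log 2 (real (w (map X [t..<t + l])) / W))
      - 2 * real l * log 2 W"
proof -
  obtain m where m: "l = Suc m" using l by (cases l) auto
  let ?G = "window_gambler w l" and ?Y = "padded m X"
  define h where "h t = (\<Sum>i=1..l. log 2 (cond_weight w l ?Y i t))" for t
  have W: "W > 0" "W \<ge> 1" using ext_weight_pos[of w l "[]", OF w] by (auto simp: W_def)
  have h: "h t = log 2 (real (w (map ?Y [t..<t + l]))) - log 2 W" for t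
    using sum_log_cond_weight[of w l l ?Y t, OF w] by (simp add: h_def ext_weight_full W_def)
  have h_ge: "h t \<ge> - log 2 W" for t
    using w[of "map ?Y [t..<t + l]"] unfolding h by simp
  have bf: "bet_factor ?G i (state_after ?G (prefix_of X t)) (X t) = cond_weight w l ?Y i (t + (l - i))"
    if "i \<in> {1..l}" for i t
    using bet_factor_window_gambler[of w i m X t, OF w] that unfolding m by blast
  have cap: "capital ?G = 1" by (simp add: window_gambler_def)
  have "log 2 (product_gale l ?G s (prefix_of X n)) = log 2 (capital ?G) + real l * s * real n
      + (\<Sum>i=1..l. \<Sum>t<n. log 2 (bet_factor ?G i (state_after ?G (prefix_of X t)) (X t)))"
    by (rule log_product_gale) (simp add: cap, rule bet_factor_window_gambler_pos[OF w])
  also note cap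
  also have "(\<Sum>i=1..l. \<Sum>t<n. log 2 (bet_factor ?G i (state_after ?G (prefix_of X t)) (X t))) =
      (\<Sum>i=1..l. \<Sum>t<n. log 2 (cond_weight w l ?Y i (t + (l - i))))"
    by (intro sum.cong refl) (simp add: bf)
  finally have gain: "log 2 (product_gale l ?G s (prefix_of X n)) = real l * s * real n
      + (\<Sum>i=1..l. \<Sum>t<n. log 2 (cond_weight w l ?Y i (t + (l - i))))" by simp
  \<comment> \<open>Bet \<open>i\<close> at time \<open>t\<close> concerns the window starting at \<open>t + (l - i)\<close> of the padded sequence; regrouping
    by windows, the conditional probabilities telescope.\<close>
  have "(\<Sum>t<n + l. h t) = (\<Sum>i=1..l. \<Sum>t<n + l. log 2 (cond_weight w l ?Y i t))"
    unfolding h_def by (rule sum.swap)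
  also have "\<dots> \<le> (\<Sum>i=1..l. \<Sum>t<n. log 2 (cond_weight w l ?Y i (t + (l - i))))"
    using cond_weight_bounds[of w, OF w] by (intro sum_mono sum_shift_ge) auto
  finally have le: "(\<Sum>t<n + l. h t) \<le> \<dots>" .
  have sub: "{m..<n - l + 1 + m} \<subseteq> {..<n + l}" using m l by auto
  have "(\<Sum>t<n + l. h t) = (\<Sum>t\<in>{m..<n - l + 1 + m}. h t) + (\<Sum>t\<in>{..<n + l} - {m..<n - l + 1 + m}. h t)"
    using sub by (subst sum.subset_diff[OF sub]) auto
  moreover have "(\<Sum>t\<in>{m..<n - l + 1 + m}. h t) = (\<Sum>t<n - l + 1. h (t + m))"
    using sum.shift_bounds_nat_ivl[of h 0 m "n - l + 1"] by (simp add: atLeast0LessThan)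
  moreover have "h (t + m) = log 2 (real (w (map X [t..<t + l])) / W)" for t
    unfolding h map_padded using w W by (simp add: log_divide)
  \<comment> \<open>Of the \<open>n + l\<close> padded windows, \<open>n - l + 1\<close> lie inside
    the prefix of \<open>X\<close>. Each of the other \<open>2 * l - 1\<close> costs at most
    \<open>log 2 W\<close>, because all weights are at least 1.\<close>
  moreover have "(\<Sum>t\<in>{..<n + l} - {m..<n - l + 1 + m}. h t) \<ge> - (2 * real l * log 2 W)"
  proof -
    have "card ({..<n + l} - {m..<n - l + 1 + m}) = 2 * l - 1"
      using m l by (subst card_Diff_subset[OF _ sub]) auto
    then have "real (card ({..<n + l} - {m..<n - l + 1 + m})) \<le> 2 * real l"
      by (metis diff_le_self of_nat_le_iff of_nat_mult of_nat_numeral)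
    then have "- (2 * real l * log 2 W) \<le> real (card ({..<n + l} - {m..<n - l + 1 + m})) * (- log 2 W)"
      using W by (simp add: mult_right_mono)
    also have "\<dots> \<le> (\<Sum>t\<in>{..<n + l} - {m..<n - l + 1 + m}. h t)"
      using h_ge by (intro sum_bounded_below) auto
    finally show ?thesis .
  qed
  ultimately show ?thesis using le gain by simp
qed

text \<open>Rounding up to integer weights keeps the dominance \<open>p \<le> (1 + |A| / M) \<cdot> w / W\<close> exact, which bounds the
  relative entropy, while only finitely many \<open>w\<close> occur.\<close>

lemma integer_weights_dominate:
  fixes p :: "'a \<Rightarrow> real"
  assumes "finite A" "sum p A = 1" "\<And>u. u \<in> A \<Longrightarrow> p u \<ge> 0" and M: "M > 0" and u: "u \<in> A"
  defines "w \<equiv> \<lambda>u. nat \<lfloor>real M * p u\<rfloor> + 1"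
  shows "p u \<le> (1 + real (card A) / real M) * (real (w u) / real (sum w A))"
proof -
  have w: "real M * p v \<le> real (w v)" "real (w v) \<le> real M * p v + 1" if "v \<in> A" for v
    using assms(3)[OF that] M unfolding w_def by (auto simp: of_nat_nat) linarith+
  \<comment> \<open>Rounding adds at most 1 per element, hence at most \<open>card A\<close> to the
    total mass \<open>M\<close>.\<close>
  have "(\<Sum>v\<in>A. real (w v)) \<le> (\<Sum>v\<in>A. real M * p v + 1)" using w(2) by (rule sum_mono)
  also have "\<dots> = real M + real (card A)"
    by (simp add: sum.distrib sum_distrib_left[symmetric] assms(2))
  finally have W: "real (sum w A) \<le> real M + real (card A)" by simp
  have "w u \<le> sum w A" using assms(1) u by (intro member_le_sum) auto
  moreover have "w u \<ge> 1" by (simp add: w_def)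
  ultimately have "sum w A > 0" by linarith
  then have Wp: "real (sum w A) > 0" by (rule of_nat_0_less_iff[THEN iffD2])
  have "p u \<le> real (w u) / real M" using w(1)[OF u] M by (simp add: field_simps)
  also have "\<dots> = (real (sum w A) / real M) * (real (w u) / real (sum w A))" using Wp by simp
  also have "\<dots> \<le> ((real M + real (card A)) / real M) * (real (w u) / real (sum w A))"
    using W M by (intro mult_right_mono divide_right_mono) (auto intro!: divide_nonneg_nonneg sum_nonneg)
  also have "(real M + real (card A)) / real M = 1 + real (card A) / real M"
    using M by (simp add: field_simps)
  finally show ?thesis .
qed

text \<open>Taking logarithms in the dominance of the frequencies by the normalised weights and
  averaging over blocks shows that the weights do worse than the true frequencies by at most
  \<open>log 2 (1 + 2 ^ l / real M)\<close> per window.\<close>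

lemma sum_windows_log_weights_ge:
  fixes M :: nat
  assumes l: "l \<ge> 1" "l \<le> n" and M: "M > 0"
    and w: "\<And>u. length u = l \<Longrightarrow> w u = nat \<lfloor>real M * frequency u (prefix_of X n)\<rfloor> + 1"
  shows "(\<Sum>t<n - l + 1. log 2 (real (w (map X [t..<t + l])) / real (ext_weight w l []))) \<ge>
    - (real (n - l + 1) * (real l * block_entropy l (prefix_of X n) + log 2 (1 + 2 ^ l / real M)))"
proof -
  let ?A = "{u :: bool list. length u = l}" and ?W = "real (ext_weight w l [])"
  define p where "p u = frequency u (prefix_of X n)" for u
  define N where "N = real (n - l + 1)"
  define c where "c = 1 + 2 ^ l / real M"
  have c: "c > 0" unfolding c_def by (intro add_pos_nonneg) auto
  have N: "N > 0" by (simp add: N_def)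
  have p0: "p u \<ge> 0" if "u \<in> ?A" for u
    using that unfolding p_def by (auto intro!: frequency_nonneg[OF _ l(2)])
  have Weq: "ext_weight w l [] = (\<Sum>u\<in>?A. nat \<lfloor>real M * p u\<rfloor> + 1)"
    by (simp add: ext_weight_def w p_def)
  have dom: "p u \<le> c * (real (w u) / ?W)" if u: "u \<in> ?A" for u
  proof -
    have "sum p ?A = 1" unfolding p_def by (rule sum_frequency[OF l(2)])
    from integer_weights_dominate[OF finite_lists_length this p0 M u]
    show ?thesis unfolding Weq using u w by (simp add: card_lists_length c_def p_def)
  qed
  have "p u * log 2 (real (w u) / ?W) \<ge> p u * log 2 (p u) - p u * log 2 c" if u: "u \<in> ?A" for u
  proof (cases "p u = 0")
    case False
    then have pu: "p u > 0" using p0[OF u] by simp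
    then have q: "real (w u) / ?W > 0" using dom[OF u] c
      by (metis less_le_trans zero_less_mult_pos)
    have "log 2 (p u) \<le> log 2 (c * (real (w u) / ?W))"
      using dom[OF u] pu by simp
    also have "\<dots> = log 2 c + log 2 (real (w u) / ?W)"
      using c q by (intro log_mult_pos)
    finally have "p u * log 2 (p u) \<le> p u * (log 2 c + log 2 (real (w u) / ?W))"
      using pu by (intro mult_left_mono) auto
    then show ?thesis by (simp add: algebra_simps)
  qed simp
  then have "(\<Sum>u\<in>?A. p u * log 2 (p u) - p u * log 2 c) \<le> (\<Sum>u\<in>?A. p u * log 2 (real (w u) / ?W))"
    by (rule sum_mono)
  moreover have "(\<Sum>u\<in>?A. p u * log 2 (p u) - p u * log 2 c) =
      - (real l * block_entropy l (prefix_of X n) + log 2 c)"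
    using sum_frequency[OF l(2), of X] unfolding block_entropy_altdef[OF l(1)]
    by (simp add: sum_subtractf sum_distrib_right[symmetric] p_def)
  ultimately have "N * - (real l * block_entropy l (prefix_of X n) + log 2 c)
      \<le> N * (\<Sum>u\<in>?A. p u * log 2 (real (w u) / ?W))"
    using N by (intro mult_left_mono) auto
  also have "\<dots> = (\<Sum>u\<in>?A. real (occurrences u (prefix_of X n)) * log 2 (real (w u) / ?W))"
    unfolding sum_distrib_left
    by (intro sum.cong refl) (auto simp: occurrences_eq_frequency[OF _ l(2)] N_def p_def)
  also have "\<dots> = (\<Sum>t<n - l + 1. log 2 (real (w (map X [t..<t + l])) / ?W))"
    using sum_windows[OF l(2), of "\<lambda>u. log 2 (real (w u) / ?W)" X] by simp
  finally show ?thesis unfolding N_def c_def by (simp only: mult_minus_right)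
qed

section \<open>From low entropy infinitely often to one successful gambler\<close>

lemma succeeds_onI:
  assumes "\<And>K. \<exists>\<^sub>F n in sequentially. d (prefix_of X n) > K"
  shows "succeeds_on d X"
proof (rule ccontr)
  assume "\<not> ?thesis"
  then have "limsup (\<lambda>n. ereal (d (prefix_of X n))) < \<infinity>"
    by (simp add: succeeds_on_def)
  then obtain K where "limsup (\<lambda>n. ereal (d (prefix_of X n))) < ereal K"
    using ereal_dense2 by blast
  then have "\<forall>\<^sub>F n in sequentially. ereal (d (prefix_of X n)) < ereal K"
    by (rule Limsup_lessD)
  then have "\<forall>\<^sub>F n in sequentially. \<not> d (prefix_of X n) > K"
    by eventually_elim auto
  with assms[of K] show False by (simp add: frequently_def)
qed

text \<open>The rounded frequencies vary with \<open>n\<close> but take only finitely many values,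
  so by the pigeonhole principle one weight function fits infinitely many prefixes of low entropy.
  Its window gambler gains linearly in \<open>n\<close> along these.\<close>

lemma ex_gambler_if_liminf_less:
  assumes l: "l \<ge> 1" and s: "s \<ge> 0" and less: "liminf_block_entropy l X < ereal s"
  shows "\<exists>G :: nat gambler. is_gambler l G \<and> succeeds_on (product_gale l G s) X"
proof -
  obtain s' where s': "liminf_block_entropy l X < ereal s'" "s' < s"
    using ereal_dense2[OF less] by auto
  define I where "I = {n. l \<le> n \<and> block_entropy l (prefix_of X n) < s'}"
  have "\<exists>\<^sub>F n in sequentially. block_entropy l (prefix_of X n) < s'"
  proof (rule ccontr)
    assume "\<not> ?thesis"
    then have "\<forall>\<^sub>F n in sequentially. ereal s' \<le> ereal (block_entropy l (prefix_of X n))"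
      by (simp add: frequently_def not_less)
    then have "ereal s' \<le> liminf (\<lambda>n. ereal (block_entropy l (prefix_of X n)))"
      by (rule Liminf_bounded)
    with s'(1) show False by (simp add: liminf_block_entropy_def)
  qed
  from frequently_eventually_frequently[OF this eventually_ge_at_top[of l]]
  have "\<exists>\<^sub>F n in sequentially. l \<le> n \<and> block_entropy l (prefix_of X n) < s'"
    by (rule frequently_elim1) simp
  then have I: "infinite I"
    unfolding I_def by (simp add: frequently_cofinite flip: cofinite_eq_sequentially)
  \<comment> \<open>\<open>e\<close> is the surplus in bits per window. Choosing \<open>M\<close>
    large spends less than half of it on rounding, and the other half drives the growth.\<close>
  define e where "e = real l * (s - s')"
  have e: "e > 0" using l s' by (simp add: e_def)
  have "(\<lambda>M. log 2 (1 + 2 ^ l / real M)) \<longlonglongrightarrow> log 2 (1 + 0)"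
    by (intro tendsto_intros lim_const_over_n) auto
  then have "\<forall>\<^sub>F M in sequentially. log 2 (1 + 2 ^ l / real M) < e / 2"
    using e by (intro order_tendstoD) auto
  then have "\<forall>\<^sub>F M in sequentially. log 2 (1 + 2 ^ l / real M) < e / 2 \<and> 0 < M"
    using eventually_gt_at_top[of "0::nat"] by eventually_elim auto
  then obtain M :: nat where M: "log 2 (1 + 2 ^ l / real M) < e / 2" "M > 0"
    by (auto dest: eventually_happens)
  \<comment> \<open>The constant value 1 off the \<open>l\<close>-blocks and the bound
    \<open>M + 1\<close> on them confine all \<open>wt n\<close> with \<open>n\<close> in
    \<open>I\<close> to a finite set of functions.\<close>
  define wt where "wt n u = (if length u = l then nat \<lfloor>real M * frequency u (prefix_of X n)\<rfloor> + 1 else 1)"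
    for n and u :: "bool list"
  have "wt ` I \<subseteq> {w. \<forall>u. (u \<in> {u. length u = l} \<longrightarrow> w u \<in> {..M + 1}) \<and> (u \<notin> {u. length u = l} \<longrightarrow> w u = 1)}"
  proof -
    have "nat \<lfloor>real M * frequency u (prefix_of X n)\<rfloor> \<le> M" if "length u = l" "l \<le> n" for u n
    proof -
      have "real M * frequency u (prefix_of X n) \<le> real M * 1"
        using frequency_le_1[OF that] by (intro mult_left_mono) auto
      then show ?thesis by linarith
    qed
    then show ?thesis by (auto simp: wt_def I_def)
  qed
  then have "finite (wt ` I)"
    by (rule finite_subset) (intro finite_set_of_finite_funs finite_lists_length, simp)
  from pigeonhole_infinite[OF I this] obtain n0 where n0: "infinite {n \<in> I. wt n = wt n0}" by auto
  define w where "w = wt n0"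
  have wpos: "w u > 0" for u by (simp add: w_def wt_def)
  define L where "L = 2 * real l * log 2 (real (ext_weight w l []))"
  let ?d = "\<lambda>n. product_gale l (window_gambler w l) s (prefix_of X n)"
  have gain: "log 2 (?d n) \<ge> (real n - real l) * (e / 2) - L" if n: "n \<in> I" "wt n = w" for n
  proof -
    have ln: "l \<le> n" and H: "block_entropy l (prefix_of X n) < s'" using n by (auto simp: I_def)
    define N where "N = real (n - l + 1)"
    have N: "N \<ge> 0" "N \<ge> real n - real l" "N \<le> real n" using ln l by (auto simp: N_def)
    have "real l * block_entropy l (prefix_of X n) \<le> real l * s'"
      using H by (intro mult_left_mono) auto
    moreover have "e = real l * s - real l * s'" by (simp add: e_def right_diff_distrib)
    ultimately have "real l * block_entropy l (prefix_of X n) + log 2 (1 + 2 ^ l / real M)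
        \<le> real l * s - e / 2"
      using M(1) by linarith
    then have "N * (real l * block_entropy l (prefix_of X n) + log 2 (1 + 2 ^ l / real M))
        \<le> N * (real l * s - e / 2)"
      using N by (intro mult_left_mono) auto
    moreover have "(\<Sum>t<n - l + 1. log 2 (real (w (map X [t..<t + l])) / real (ext_weight w l [])))
        \<ge> - (N * (real l * block_entropy l (prefix_of X n) + log 2 (1 + 2 ^ l / real M)))"
      unfolding N_def using n(2) by (intro sum_windows_log_weights_ge l ln M) (auto simp: wt_def)
    moreover have "log 2 (?d n) \<ge> real l * s * real n +
        (\<Sum>t<n - l + 1. log 2 (real (w (map X [t..<t + l])) / real (ext_weight w l []))) - L"
      unfolding L_def by (rule window_gambler_gain[OF wpos l ln])
    moreover have "N * (real l * s) \<le> real n * (real l * s)" using N s by (intro mult_right_mono) auto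
    moreover have "(real n - real l) * (e / 2) \<le> N * (e / 2)" using N e by (intro mult_right_mono) auto
    ultimately show ?thesis by (simp add: algebra_simps)
  qed
  have "succeeds_on (product_gale l (window_gambler w l) s) X"
  proof (rule succeeds_onI)
    fix K :: real
    have "filterlim (\<lambda>n. - (real l * (e / 2)) - L + (e / 2) * real n) at_top sequentially"
      using e by (intro filterlim_tendsto_add_at_top[OF tendsto_const]
        filterlim_tendsto_pos_mult_at_top[OF tendsto_const] filterlim_real_sequentially) auto
    \<comment> \<open>The maximum with 1 keeps the argument of the logarithm positive for every
      \<open>K\<close>.\<close>
    then have "\<forall>\<^sub>F n in sequentially. - (real l * (e / 2)) - L + (e / 2) * real n > log 2 (max 1 K)"
      by (rule filterlim_at_top_dense[THEN iffD1, rule_format])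
    moreover have "\<exists>\<^sub>F n in sequentially. n \<in> I \<and> wt n = w"
      using n0 by (simp add: w_def frequently_cofinite flip: cofinite_eq_sequentially)
    ultimately have "\<exists>\<^sub>F n in sequentially. (n \<in> I \<and> wt n = w) \<and>
        - (real l * (e / 2)) - L + (e / 2) * real n > log 2 (max 1 K)"
      by (rule frequently_eventually_frequently[rotated])
    then show "\<exists>\<^sub>F n in sequentially. ?d n > K"
    proof (rule frequently_elim1)
      fix n
      assume n: "(n \<in> I \<and> wt n = w) \<and>
        - (real l * (e / 2)) - L + (e / 2) * real n > log 2 (max 1 K)"
      have d: "?d n > 0"
      proof -
        have "capital (window_gambler w l) > 0" by (simp add: window_gambler_def)
        then show ?thesis
          unfolding product_gale_prefix_of
          by (intro mult_pos_pos prod_pos bet_factor_window_gambler_pos wpos) auto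
      qed
      have "log 2 (?d n) > log 2 (max 1 K)"
        using gain[of n] n by (simp add: algebra_simps)
      then have "?d n > max 1 K" using d by simp
      then show "?d n > K" by simp
    qed
  qed
  moreover have "is_gambler l (window_gambler w l)"
    using wpos l by (rule window_gambler_is_gambler)
  ultimately show ?thesis by (intro exI conjI)
qed

section \<open>The two inequalities combined\<close>

theorem theorem3:
  fixes X :: "nat \<Rightarrow> bool"
  shows "ereal (multi_bet_dim X) = sliding_entropy_rate X"
proof (rule antisym)
  have bdd: "bdd_below (multi_bet_set X)"
    by (rule bdd_belowI[of _ 0]) (auto simp: multi_bet_set_def)
  have dim_le_1: "multi_bet_dim X \<le> 1"
  proof (cases "multi_bet_set X = {}")
    case False
    then obtain s where s: "s \<in> multi_bet_set X" by blast
    then have "s \<le> 1" by (simp add: multi_bet_set_def)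
    then show ?thesis using cInf_lower[OF s bdd] False by (simp add: multi_bet_dim_def)
  qed (simp add: multi_bet_dim_def)
  show "ereal (multi_bet_dim X) \<le> sliding_entropy_rate X"
    unfolding sliding_entropy_rate_def
  proof (rule INF_greatest)
    fix l :: nat
    assume "l \<in> {1..}"
    then have l: "l \<ge> 1" by simp
    \<comment> \<open>A value \<open>s\<close> strictly between the two sides must lie in [0, 1] to
      belong to \<open>multi_bet_set X\<close>: nonnegativity of the entropy gives the lower end and
      \<open>dim_le_1\<close> the upper one.\<close>
    have "\<forall>\<^sub>F n in sequentially. 0 \<le> ereal (block_entropy l (prefix_of X n))"
      using eventually_ge_at_top[of l] by eventually_elim (simp add: block_entropy_nonneg[OF l])
    then have nonneg: "0 \<le> liminf_block_entropy l X"
      unfolding liminf_block_entropy_def by (rule Liminf_bounded)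
    show "ereal (multi_bet_dim X) \<le> liminf_block_entropy l X"
    proof (rule ccontr)
      assume "\<not> ?thesis"
      then have "liminf_block_entropy l X < ereal (multi_bet_dim X)" by simp
      from ereal_dense2[OF this]
      obtain s where s: "liminf_block_entropy l X < ereal s" "s < multi_bet_dim X" by auto
      from nonneg s(1) have "0 < ereal s" by (rule le_less_trans)
      then have "s \<in> multi_bet_set X"
        using ex_gambler_if_liminf_less[OF l _ s(1)] s(2) dim_le_1 l
        unfolding multi_bet_set_def by auto
      then show False using cInf_lower[OF _ bdd, of s] s(2) by (auto simp: multi_bet_dim_def split: if_splits)
    qed
  qed
  show "sliding_entropy_rate X \<le> ereal (multi_bet_dim X)"
  proof (cases "multi_bet_set X = {}")
    case True
    \<comment> \<open>By convention the dimension is 1 here, and the entropy of single bits never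
      exceeds 1.\<close>
    have "\<forall>\<^sub>F n in sequentially. ereal (block_entropy 1 (prefix_of X n)) \<le> 1"
      using eventually_ge_at_top[of 1] by eventually_elim (simp add: block_entropy_le_1)
    then have "limsup (\<lambda>n. ereal (block_entropy 1 (prefix_of X n))) \<le> 1"
      by (rule Limsup_bounded)
    then have "liminf_block_entropy 1 X \<le> 1"
      unfolding liminf_block_entropy_def
      using Liminf_le_Limsup[of sequentially "\<lambda>n. ereal (block_entropy 1 (prefix_of X n))"]
      by (meson order_trans sequentially_bot)
    then show ?thesis
      unfolding sliding_entropy_rate_def multi_bet_dim_def using True
      by (auto intro!: INF_lower2[of 1] simp: one_ereal_def)
  next
    case False
    show ?thesis
    proof (rule ccontr)
      assume "\<not> ?thesis"
      then have "ereal (multi_bet_dim X) < sliding_entropy_rate X" by simp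
      from ereal_dense2[OF this]
      obtain c where c: "multi_bet_dim X < c" "ereal c < sliding_entropy_rate X" by auto
      obtain s where s: "s \<in> multi_bet_set X" "s < c"
        using cInf_lessD[OF False, of c] c(1) False by (auto simp: multi_bet_dim_def)
      then obtain k and G :: "nat gambler"
        where "is_gambler k G" "succeeds_on (product_gale k G s) X" "s \<ge> 0"
        by (auto simp: multi_bet_set_def)
      then have "sliding_entropy_rate X \<le> ereal s" by (rule sliding_entropy_rate_le)
      also have "\<dots> < ereal c" using s(2) by simp
      finally show False using c(2) by simp
    qed
  qed
qed

end
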